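(* Let $\kappa$ be an infinite cardinal, $n\in\mathbb{N}$ (so $n\geq 1$), $[\kappa]^{n}=\{F\subset\kappa: |F|=n\}$, and $x\in\kappa$. Let $\mathbf{F}_{\kappa}^{\flat}$ denote the hyperballean of the ballean $\mathbf{F}_{\kappa}$. Then the following statements hold: (i) the subballean of $\mathbf{F}_{\kappa}^{\flat}$ with the support $[\kappa]^{n}$ is asymptotically scattered; (ii) the subballean of $\mathbf{F}_{\kappa}^{\flat}$ with the support $\{F\in\mathcal{F}_{\kappa}: x\in F\}$ is asymorphic to $\mathbf{Q}_{\kappa}$; (iii) $\mathbf{F}_{\omega}^{\flat}$ can be partitioned into countably many pairwise close Cantor macrocubes (i.e. the support of $\mathbf{F}_{\omega}^{\flat}$ can be partitioned into countably many subsets which are pairwise close in $\mathbf{F}_{\omega}^{\flat}$ and such that the subballean on each of them is asymorphic to $\mathbf{Q}_{\omega}$), but $\mathbf{F}_{\omega}^{\flat}$ is not coarsely equivalent to $\mathbf{Q}_{\omega}$.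
   Context: A ball structure is a triple $\mathcal{B}=(X,P,B)$, where $X,P$ are non-empty sets and, for all $x\in X$ and $\alpha\in P$, $B(x,\alpha)$ is a subset of $X$ with $x\in B(x,\alpha)$, called the ball of radius $\alpha$ around $x$. The set $X$ is the support of $\mathcal{B}$ and $P$ is the set of radii. For $x\in X$, $A\subseteq X$, $\alpha\in P$ put $B^{*}(x,\alpha)=\{y\in X: x\in B(y,\alpha)\}$ and $B(A,\alpha)=\bigcup_{a\in A}B(a,\alpha)$. A ball structure $\mathcal{B}=(X,P,B)$ is a ballean if: (1) for any $\alpha,\beta\in P$ there exist $\alpha',\beta'\in P$ such that for every $x\in X$, $B(x,\alpha)\subseteq B^{*}(x,\alpha')$ and $B^{*}(x,\beta)\subseteq B(x,\beta')$; (2) for any $\alpha,\beta\in P$ there exists $\gamma\in P$ such that for every $x\in X$, $B(B(x,\alpha),\beta)\subseteq B(x,\gamma)$; (3) for any $x,y\in X$ there exists $\alpha\in P$ such that $y\in B(x,\alpha)$. Standing convention: all balleans are assumed symmetric, i.e. $B(x,\alpha)=B^{*}(x,\alpha)$ for all $x\in X$, $\alpha\in P$. For balleans $\mathcal{B}=(X,P,B)$ and $\mathcal{B}'=(X',P',B')$, a mapping $f:X\to X'$ is coarse if for every $\alpha\in P$ there exists $\alpha'\in P'$ such that $f(B(x,\alpha))\subseteq B'(f(x),\alpha')$ for every $x\in X$. A bijection $f:X\to X'$ is an asymorphism if $f$ and $f^{-1}$ are coarse; in this case $\mathcal{B}$ and $\mathcal{B}'$ are called asymorphic. For a non-empty subset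 $Y\subseteq X$, the subballean $\mathcal{B}_{Y}$ (with the support $Y$) is $(Y,P,B_{Y})$ with $B_{Y}(y,\alpha)=Y\cap B(y,\alpha)$. A subset $Y\subseteq X$ is large if $X=B(Y,\alpha)$ for some $\alpha\in P$. Balleans $\mathcal{B}$ and $\mathcal{B}'$ with supports $X$ and $X'$ are coarsely equivalent if there exist large subsets $Y\subseteq X$ and $Y'\subseteq X'$ such that $\mathcal{B}_{Y}$ and $\mathcal{B}'_{Y'}$ are asymorphic. A subset $Y\subseteq X$ is bounded if there exist $x\in X$ and $\alpha\in P$ with $Y\subseteq B(x,\alpha)$, and unbounded otherwise. Subsets $Y,Z$ of $X$ are close if there exists $\alpha\in P$ such that $Y\subseteq B(Z,\alpha)$ and $Z\subseteq B(Y,\alpha)$. A ballean $\mathcal{B}=(X,P,B)$ is asymptotically scattered if for every unbounded subset $Y$ of $X$ there is $\alpha\in P$ such that for every $\beta\in P$ there exists $y\in Y$ with $(B(y,\beta)\setminus B(y,\alpha))\cap Y=\emptyset$. Hyperballean: for a ballean $\mathcal{B}=(X,P,B)$, $X^{\flat}$ is the family of all non-empty bounded subsets of $X$, and $\mathcal{B}^{\flat}=(X^{\flat},P,B^{\flat})$, where $B^{\flat}(Y,\alpha)=\{Z\in X^{\flat}: Z\subseteq B(Y,\alpha),\ Y\subseteq B(Z,\alpha)\}$. For a non-empty set $X$, let $\mathcal{F}_{X}$ be the family of all finite subsets of $X$. Then $\mathbf{F}_{X}$ denotes the ballean $(X,\mathcal{F}_{X},B_{\mathbf{F}})$, where $B_{\mathbf{F}}(x,F)=\{x\}$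 if $x\notin F$ and $B_{\mathbf{F}}(x,F)=F$ if $x\in F$. The support of $\mathbf{F}_{X}^{\flat}$ is $\mathcal{F}_{X}\setminus\{\emptyset\}$. A cardinal $\kappa$ is identified with the set of all ordinals $\alpha<\kappa$; $\omega=\{0,1,\ldots\}$. For a cardinal $\kappa$, $\mathbf{Q}_{\kappa}$ is the ballean whose support is the set of all $(x_{\alpha})_{\alpha<\kappa}$ with $x_{\alpha}\in\{0,1\}$ and $x_{\alpha}=0$ for all but finitely many $\alpha<\kappa$, whose set of radii is $\mathcal{F}_{\kappa}$, and whose balls are $B_{\mathbf{Q}}((x_{\alpha})_{\alpha<\kappa},F)=\{(y_{\alpha})_{\alpha<\kappa}: x_{\alpha}=y_{\alpha}\text{ for all }\alpha\in\kappa\setminus F\}$, where $(y_\alpha)_{\alpha<\kappa}$ ranges over the support. The ballean $\mathbf{Q}_{\omega}$ is called the Cantor macrocube. *)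

theory Defs
  imports Main "HOL-Library.FuncSet" "HOL-Library.Disjoint_Sets" "HOL-Library.Countable_Set"
    "HOL-Library.Ramsey"
begin

section \<open>Ball structures and balleans\<close>

record ('x, 'r) ball_struct =
  supp :: "'x set"
  radii :: "'r set"
  ball :: "'x \<Rightarrow> 'r \<Rightarrow> 'x set"

definition is_ball_structure :: "('x, 'r) ball_struct \<Rightarrow> bool" where
  "is_ball_structure \<B> \<longleftrightarrow> supp \<B> \<noteq> {} \<and> radii \<B> \<noteq> {} \<and>
     (\<forall>x\<in>supp \<B>. \<forall>\<alpha>\<in>radii \<B>. ball \<B> x \<alpha> \<subseteq> supp \<B> \<and> x \<in> ball \<B> x \<alpha>)"

definition ball_star :: "('x, 'r) ball_struct \<Rightarrow> 'x \<Rightarrow> 'r \<Rightarrow> 'x set" where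
  "ball_star \<B> x \<alpha> = {y \<in> supp \<B>. x \<in> ball \<B> y \<alpha>}"

definition set_ball :: "('x, 'r) ball_struct \<Rightarrow> 'x set \<Rightarrow> 'r \<Rightarrow> 'x set" where
  "set_ball \<B> A \<alpha> = (\<Union>a\<in>A. ball \<B> a \<alpha>)"

definition is_ballean :: "('x, 'r) ball_struct \<Rightarrow> bool" where
  "is_ballean \<B> \<longleftrightarrow> is_ball_structure \<B> \<and>
     (\<forall>\<alpha>\<in>radii \<B>. \<forall>\<beta>\<in>radii \<B>. \<exists>\<alpha>'\<in>radii \<B>. \<exists>\<beta>'\<in>radii \<B>. \<forall>x\<in>supp \<B>.
        ball \<B> x \<alpha> \<subseteq> ball_star \<B> x \<alpha>' \<and> ball_star \<B> x \<beta> \<subseteq> ball \<B> x \<beta>') \<and>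
     (\<forall>\<alpha>\<in>radii \<B>. \<forall>\<beta>\<in>radii \<B>. \<exists>\<gamma>\<in>radii \<B>. \<forall>x\<in>supp \<B>.
        set_ball \<B> (ball \<B> x \<alpha>) \<beta> \<subseteq> ball \<B> x \<gamma>) \<and>
     (\<forall>x\<in>supp \<B>. \<forall>y\<in>supp \<B>. \<exists>\<alpha>\<in>radii \<B>. y \<in> ball \<B> x \<alpha>)"

definition is_symmetric :: "('x, 'r) ball_struct \<Rightarrow> bool" where
  "is_symmetric \<B> \<longleftrightarrow> (\<forall>x\<in>supp \<B>. \<forall>\<alpha>\<in>radii \<B>. ball \<B> x \<alpha> = ball_star \<B> x \<alpha>)"

definition is_coarse ::
    "('x, 'r) ball_struct \<Rightarrow> ('y, 's) ball_struct \<Rightarrow> ('x \<Rightarrow> 'y) \<Rightarrow> bool" where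
  "is_coarse \<B> \<B>' f \<longleftrightarrow> f \<in> supp \<B> \<rightarrow> supp \<B>' \<and>
     (\<forall>\<alpha>\<in>radii \<B>. \<exists>\<alpha>'\<in>radii \<B>'. \<forall>x\<in>supp \<B>. f ` ball \<B> x \<alpha> \<subseteq> ball \<B>' (f x) \<alpha>')"

definition is_asymorphism ::
    "('x, 'r) ball_struct \<Rightarrow> ('y, 's) ball_struct \<Rightarrow> ('x \<Rightarrow> 'y) \<Rightarrow> bool" where
  "is_asymorphism \<B> \<B>' f \<longleftrightarrow> bij_betw f (supp \<B>) (supp \<B>') \<and>
     is_coarse \<B> \<B>' f \<and> is_coarse \<B>' \<B> (inv_into (supp \<B>) f)"

definition asymorphic :: "('x, 'r) ball_struct \<Rightarrow> ('y, 's) ball_struct \<Rightarrow> bool" where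
  "asymorphic \<B> \<B>' \<longleftrightarrow> (\<exists>f. is_asymorphism \<B> \<B>' f)"

definition subballean :: "('x, 'r) ball_struct \<Rightarrow> 'x set \<Rightarrow> ('x, 'r) ball_struct" where
  "subballean \<B> Y = \<lparr>supp = Y, radii = radii \<B>, ball = (\<lambda>y \<alpha>. Y \<inter> ball \<B> y \<alpha>)\<rparr>"

definition large_in :: "('x, 'r) ball_struct \<Rightarrow> 'x set \<Rightarrow> bool" where
  "large_in \<B> Y \<longleftrightarrow> Y \<subseteq> supp \<B> \<and> (\<exists>\<alpha>\<in>radii \<B>. supp \<B> = set_ball \<B> Y \<alpha>)"

definition coarsely_equivalent ::
    "('x, 'r) ball_struct \<Rightarrow> ('y, 's) ball_struct \<Rightarrow> bool" where
  "coarsely_equivalent \<B> \<B>' \<longleftrightarrow> (\<exists>Y Y'. large_in \<B> Y \<and> large_in \<B>' Y' \<and>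
     asymorphic (subballean \<B> Y) (subballean \<B>' Y'))"

definition bounded_in :: "('x, 'r) ball_struct \<Rightarrow> 'x set \<Rightarrow> bool" where
  "bounded_in \<B> Y \<longleftrightarrow> Y \<subseteq> supp \<B> \<and> (\<exists>x\<in>supp \<B>. \<exists>\<alpha>\<in>radii \<B>. Y \<subseteq> ball \<B> x \<alpha>)"

definition close_in :: "('x, 'r) ball_struct \<Rightarrow> 'x set \<Rightarrow> 'x set \<Rightarrow> bool" where
  "close_in \<B> Y Z \<longleftrightarrow> Y \<subseteq> supp \<B> \<and> Z \<subseteq> supp \<B> \<and>
     (\<exists>\<alpha>\<in>radii \<B>. Y \<subseteq> set_ball \<B> Z \<alpha> \<and> Z \<subseteq> set_ball \<B> Y \<alpha>)"

definition asymptotically_scattered :: "('x, 'r) ball_struct \<Rightarrow> bool" where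
  "asymptotically_scattered \<B> \<longleftrightarrow>
     (\<forall>Y. Y \<subseteq> supp \<B> \<and> \<not> bounded_in \<B> Y \<longrightarrow>
        (\<exists>\<alpha>\<in>radii \<B>. \<forall>\<beta>\<in>radii \<B>. \<exists>y\<in>Y. (ball \<B> y \<beta> - ball \<B> y \<alpha>) \<inter> Y = {}))"

definition hyperballean :: "('x, 'r) ball_struct \<Rightarrow> ('x set, 'r) ball_struct" where
  "hyperballean \<B> =
     \<lparr>supp = {Y. Y \<noteq> {} \<and> bounded_in \<B> Y},
      radii = radii \<B>,
      ball = (\<lambda>Y \<alpha>. {Z. Z \<noteq> {} \<and> bounded_in \<B> Z \<and>
                Z \<subseteq> set_ball \<B> Y \<alpha> \<and> Y \<subseteq> set_ball \<B> Z \<alpha>})\<rparr>"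


section \<open>The balleans \<open>F\<^sub>X\<close> and \<open>Q\<^sub>\<kappa>\<close>\<close>

definition F_ballean :: "'a set \<Rightarrow> ('a, 'a set) ball_struct" where
  "F_ballean X = \<lparr>supp = X, radii = Fpow X, ball = (\<lambda>x F. if x \<in> F then F else {x})\<rparr>"

text \<open>
  The index set \<open>K\<close> plays the role of the cardinal \<open>\<kappa>\<close>, viewed as the set of all smaller ordinals.
  Families indexed by \<open>K\<close> are extensional functions, so that they are determined by their values
  on \<open>K\<close>.
\<close>

definition Q_support :: "'a set \<Rightarrow> ('a \<Rightarrow> nat) set" where
  "Q_support K = {x \<in> K \<rightarrow>\<^sub>E {0, 1}. finite {a \<in> K. x a \<noteq> 0}}"

definition Q_ballean :: "'a set \<Rightarrow> ('a \<Rightarrow> nat, 'a set) ball_struct" where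
  "Q_ballean K = \<lparr>supp = Q_support K, radii = Fpow K,
     ball = (\<lambda>x F. {y \<in> Q_support K. \<forall>a\<in>K - F. x a = y a})\<rparr>"


section \<open>All these structures are symmetric balleans\<close>

lemma is_ballean_composeE:
  assumes "is_ballean \<B>" "\<alpha> \<in> radii \<B>" "\<beta> \<in> radii \<B>"
  obtains \<gamma> where "\<gamma> \<in> radii \<B>"
    "\<forall>x\<in>supp \<B>. set_ball \<B> (ball \<B> x \<alpha>) \<beta> \<subseteq> ball \<B> x \<gamma>"
proof -
  have "\<forall>\<alpha>\<in>radii \<B>. \<forall>\<beta>\<in>radii \<B>. \<exists>\<gamma>\<in>radii \<B>. \<forall>x\<in>supp \<B>.
      set_ball \<B> (ball \<B> x \<alpha>) \<beta> \<subseteq> ball \<B> x \<gamma>"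
    using assms(1) unfolding is_ballean_def by (elim conjE) assumption
  then show ?thesis
    using assms(2,3) that by blast
qed

lemma symmetric_balleanI:
  assumes "is_ball_structure \<B>" "is_symmetric \<B>"
    and "\<And>\<alpha> \<beta>. \<alpha> \<in> radii \<B> \<Longrightarrow> \<beta> \<in> radii \<B> \<Longrightarrow>
      \<exists>\<gamma>\<in>radii \<B>. \<forall>x\<in>supp \<B>. set_ball \<B> (ball \<B> x \<alpha>) \<beta> \<subseteq> ball \<B> x \<gamma>"
    and "\<And>x y. x \<in> supp \<B> \<Longrightarrow> y \<in> supp \<B> \<Longrightarrow> \<exists>\<alpha>\<in>radii \<B>. y \<in> ball \<B> x \<alpha>"
  shows "is_ballean \<B> \<and> is_symmetric \<B>"
proof -
  have "\<exists>\<alpha>'\<in>radii \<B>. \<exists>\<beta>'\<in>radii \<B>. \<forall>x\<in>supp \<B>.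
      ball \<B> x \<alpha> \<subseteq> ball_star \<B> x \<alpha>' \<and> ball_star \<B> x \<beta> \<subseteq> ball \<B> x \<beta>'"
    if "\<alpha> \<in> radii \<B>" "\<beta> \<in> radii \<B>" for \<alpha> \<beta>
    using that assms(2) unfolding is_symmetric_def
    by (intro bexI[of _ \<alpha>] bexI[of _ \<beta>]) auto
  then show ?thesis
    using assms unfolding is_ballean_def by simp
qed

lemma F_ballean_symmetric_ballean:
  assumes "X \<noteq> {}"
  shows "is_ballean (F_ballean X) \<and> is_symmetric (F_ballean X)"
proof -
  have U: "\<alpha> \<in> Fpow X \<Longrightarrow> \<beta> \<in> Fpow X \<Longrightarrow> \<alpha> \<union> \<beta> \<in> Fpow X" for \<alpha> \<beta>
    by (auto simp: Fpow_def)
  have 2: "\<forall>x\<in>supp (F_ballean X).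
      set_ball (F_ballean X) (ball (F_ballean X) x \<alpha>) \<beta> \<subseteq> ball (F_ballean X) x (\<alpha> \<union> \<beta>)" for \<alpha> \<beta>
    by (auto simp: F_ballean_def set_ball_def split: if_splits)
  have 3: "\<forall>x\<in>X. \<forall>y\<in>X. \<exists>\<alpha>\<in>Fpow X. y \<in> ball (F_ballean X) x \<alpha>"
  proof (intro ballI)
    fix x y assume "x \<in> X" "y \<in> X"
    then show "\<exists>\<alpha>\<in>Fpow X. y \<in> ball (F_ballean X) x \<alpha>"
      by (intro bexI[of _ "{x, y}"]) (auto simp: F_ballean_def Fpow_def)
  qed
  have S: "is_symmetric (F_ballean X)"
    by (auto simp: is_symmetric_def ball_star_def F_ballean_def Fpow_def split: if_splits)
  have "is_ball_structure (F_ballean X)"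
    using assms by (auto simp: is_ball_structure_def F_ballean_def Fpow_def split: if_splits)
  moreover have "radii (F_ballean X) = Fpow X" "supp (F_ballean X) = X"
    by (simp_all add: F_ballean_def)
  ultimately show ?thesis
    using S U 2 3 by (intro symmetric_balleanI) (simp_all, blast)
qed

lemma Q_ballean_symmetric_ballean:
  "is_ballean (Q_ballean K) \<and> is_symmetric (Q_ballean K)"
proof -
  have U: "\<alpha> \<in> Fpow K \<Longrightarrow> \<beta> \<in> Fpow K \<Longrightarrow> \<alpha> \<union> \<beta> \<in> Fpow K" for \<alpha> \<beta>
    by (auto simp: Fpow_def)
  have 2: "\<forall>x\<in>supp (Q_ballean K).
      set_ball (Q_ballean K) (ball (Q_ballean K) x \<alpha>) \<beta> \<subseteq> ball (Q_ballean K) x (\<alpha> \<union> \<beta>)" for \<alpha> \<beta>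
    by (auto simp: Q_ballean_def set_ball_def) (metis DiffI)
  have 3: "\<forall>x\<in>Q_support K. \<forall>y\<in>Q_support K. \<exists>\<alpha>\<in>Fpow K. y \<in> ball (Q_ballean K) x \<alpha>"
  proof (intro ballI)
    fix x y assume "x \<in> Q_support K" "y \<in> Q_support K"
    then show "\<exists>\<alpha>\<in>Fpow K. y \<in> ball (Q_ballean K) x \<alpha>"
      by (intro bexI[of _ "{a \<in> K. x a \<noteq> 0} \<union> {a \<in> K. y a \<noteq> 0}"])
        (auto simp: Q_ballean_def Q_support_def Fpow_def)
  qed
  have S: "is_symmetric (Q_ballean K)"
    by (auto simp: is_symmetric_def ball_star_def Q_ballean_def)
  have "(\<lambda>a\<in>K. 0) \<in> Q_support K"
    by (auto simp: Q_support_def)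
  then have "is_ball_structure (Q_ballean K)"
    by (auto simp: is_ball_structure_def Q_ballean_def Fpow_def)
  moreover have "radii (Q_ballean K) = Fpow K" "supp (Q_ballean K) = Q_support K"
    by (simp_all add: Q_ballean_def)
  ultimately show ?thesis
    using S U 2 3 by (intro symmetric_balleanI) (simp_all, blast)
qed

lemma subballean_symmetric_ballean:
  assumes "is_ballean \<B>" "is_symmetric \<B>" "Y \<subseteq> supp \<B>" "Y \<noteq> {}"
  shows "is_ballean (subballean \<B> Y) \<and> is_symmetric (subballean \<B> Y)"
proof -
  have S: "is_symmetric (subballean \<B> Y)"
    using assms(2,3) unfolding is_symmetric_def subballean_def ball_star_def by auto
  have "is_ball_structure (subballean \<B> Y)"
    using assms unfolding is_ballean_def is_ball_structure_def subballean_def by auto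
  moreover have "\<exists>\<gamma>\<in>radii \<B>. \<forall>x\<in>Y.
      set_ball (subballean \<B> Y) (ball (subballean \<B> Y) x \<alpha>) \<beta> \<subseteq> ball (subballean \<B> Y) x \<gamma>"
    if "\<alpha> \<in> radii \<B>" "\<beta> \<in> radii \<B>" for \<alpha> \<beta>
  proof -
    obtain \<gamma> where "\<gamma> \<in> radii \<B>"
      "\<forall>x\<in>supp \<B>. set_ball \<B> (ball \<B> x \<alpha>) \<beta> \<subseteq> ball \<B> x \<gamma>"
      by (rule is_ballean_composeE[OF assms(1) \<open>\<alpha> \<in> radii \<B>\<close> \<open>\<beta> \<in> radii \<B>\<close>])
    then show ?thesis
      using assms(3) unfolding set_ball_def subballean_def
      by (intro bexI[of _ \<gamma>]) (simp_all, blast)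
  qed
  moreover have "\<exists>\<alpha>\<in>radii \<B>. y \<in> ball (subballean \<B> Y) x \<alpha>" if "x \<in> Y" "y \<in> Y" for x y
  proof -
    have "\<exists>\<alpha>\<in>radii \<B>. y \<in> ball \<B> x \<alpha>"
      using assms(1) subsetD[OF assms(3) that(1)] subsetD[OF assms(3) that(2)]
      unfolding is_ballean_def by simp
    then show ?thesis
      using that by (simp add: subballean_def)
  qed
  moreover have "radii (subballean \<B> Y) = radii \<B>" "supp (subballean \<B> Y) = Y"
    by (simp_all add: subballean_def)
  ultimately show ?thesis
    using S by (intro symmetric_balleanI) simp_all
qed

lemma hyperballean_symmetric_ballean:
  assumes "is_ballean \<B>" "is_symmetric \<B>"
  shows "is_ballean (hyperballean \<B>) \<and> is_symmetric (hyperballean \<B>)"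
proof (rule symmetric_balleanI)
  have refl: "x \<in> ball \<B> x \<alpha>" if "x \<in> supp \<B>" "\<alpha> \<in> radii \<B>" for x \<alpha>
    using assms(1) that unfolding is_ballean_def is_ball_structure_def by blast
  have sub: "Y \<subseteq> set_ball \<B> Y \<alpha>" if "Y \<subseteq> supp \<B>" "\<alpha> \<in> radii \<B>" for Y \<alpha>
    using refl that unfolding set_ball_def by blast
  have comp: "\<exists>\<gamma>\<in>radii \<B>. \<forall>x\<in>supp \<B>. set_ball \<B> (ball \<B> x \<alpha>) \<beta> \<subseteq> ball \<B> x \<gamma>"
    if "\<alpha> \<in> radii \<B>" "\<beta> \<in> radii \<B>" for \<alpha> \<beta>
    by (rule is_ballean_composeE[OF assms(1) that]) blast
  have sym: "y \<in> ball \<B> x \<alpha> \<Longrightarrow> x \<in> ball \<B> y \<alpha>"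
    if "x \<in> supp \<B>" "\<alpha> \<in> radii \<B>" for x y \<alpha>
    using assms(2) that unfolding is_symmetric_def ball_star_def by blast
  have bsupp: "Y \<subseteq> supp \<B>" if "bounded_in \<B> Y" for Y
    using that unfolding bounded_in_def by blast
  have ne: "supp \<B> \<noteq> {}" "radii \<B> \<noteq> {}"
    using assms(1) unfolding is_ballean_def is_ball_structure_def by blast+
  obtain x \<alpha> where "x \<in> supp \<B>" "\<alpha> \<in> radii \<B>"
    using ne by blast
  then have "bounded_in \<B> {x}"
    using refl unfolding bounded_in_def by blast
  then show "is_ball_structure (hyperballean \<B>)"
    using ne sub bsupp unfolding is_ball_structure_def hyperballean_def by auto
  show "is_symmetric (hyperballean \<B>)"
    unfolding is_symmetric_def hyperballean_def ball_star_def by auto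
  show "\<exists>\<gamma>\<in>radii (hyperballean \<B>). \<forall>Y\<in>supp (hyperballean \<B>).
      set_ball (hyperballean \<B>) (ball (hyperballean \<B>) Y \<alpha>) \<beta> \<subseteq> ball (hyperballean \<B>) Y \<gamma>"
    if rad: "\<alpha> \<in> radii (hyperballean \<B>)" "\<beta> \<in> radii (hyperballean \<B>)" for \<alpha> \<beta>
  proof -
    have ab: "\<alpha> \<in> radii \<B>" "\<beta> \<in> radii \<B>"
      using rad by (simp_all add: hyperballean_def)
    obtain \<gamma> where \<gamma>: "\<gamma> \<in> radii \<B>"
      "\<And>x. x \<in> supp \<B> \<Longrightarrow> set_ball \<B> (ball \<B> x \<alpha>) \<beta> \<subseteq> ball \<B> x \<gamma>"
      using comp ab by blast
    have "W \<subseteq> set_ball \<B> Y \<gamma>" "Y \<subseteq> set_ball \<B> W \<gamma>"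
      if bd: "bounded_in \<B> Y" "bounded_in \<B> Z" "bounded_in \<B> W"
        and YZ: "Z \<subseteq> set_ball \<B> Y \<alpha>" "Y \<subseteq> set_ball \<B> Z \<alpha>"
        and ZW: "W \<subseteq> set_ball \<B> Z \<beta>" "Z \<subseteq> set_ball \<B> W \<beta>" for Y Z W
    proof -
      show "W \<subseteq> set_ball \<B> Y \<gamma>"
      proof
        fix w assume "w \<in> W"
        then obtain z where z: "z \<in> Z" "w \<in> ball \<B> z \<beta>"
          using ZW unfolding set_ball_def by blast
        then obtain y where y: "y \<in> Y" "z \<in> ball \<B> y \<alpha>"
          using YZ unfolding set_ball_def by blast
        then have "w \<in> ball \<B> y \<gamma>"
          using z \<gamma>(2) bsupp[OF bd(1)] unfolding set_ball_def by blast
        then show "w \<in> set_ball \<B> Y \<gamma>"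
          using y unfolding set_ball_def by blast
      qed
      show "Y \<subseteq> set_ball \<B> W \<gamma>"
      proof
        fix y assume y: "y \<in> Y"
        then obtain z where z: "z \<in> Z" "y \<in> ball \<B> z \<alpha>"
          using YZ unfolding set_ball_def by blast
        then obtain w where w: "w \<in> W" "z \<in> ball \<B> w \<beta>"
          using ZW unfolding set_ball_def by blast
        have "z \<in> ball \<B> y \<alpha>" "w \<in> ball \<B> z \<beta>"
          using z w y sym ab bsupp bd by blast+
        then have "w \<in> ball \<B> y \<gamma>"
          using y \<gamma>(2) bsupp[OF bd(1)] unfolding set_ball_def by blast
        then have "y \<in> ball \<B> w \<gamma>"
          using sym \<gamma>(1) y bsupp[OF bd(1)] by blast
        then show "y \<in> set_ball \<B> W \<gamma>"
          using w unfolding set_ball_def by blast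
      qed
    qed
    note key = this
    show ?thesis
    proof (intro bexI[of _ \<gamma>] ballI subsetI)
      fix Y W
      assume "Y \<in> supp (hyperballean \<B>)"
        "W \<in> set_ball (hyperballean \<B>) (ball (hyperballean \<B>) Y \<alpha>) \<beta>"
      then obtain Z where *: "bounded_in \<B> Y" "bounded_in \<B> Z" "bounded_in \<B> W" "W \<noteq> {}"
        "Z \<subseteq> set_ball \<B> Y \<alpha>" "Y \<subseteq> set_ball \<B> Z \<alpha>"
        "W \<subseteq> set_ball \<B> Z \<beta>" "Z \<subseteq> set_ball \<B> W \<beta>"
        unfolding set_ball_def[of "hyperballean \<B>"] by (auto simp: hyperballean_def)
      show "W \<in> ball (hyperballean \<B>) Y \<gamma>"
        using *(3,4) key[OF *(1,2,3,5,6,7,8)] by (simp add: hyperballean_def)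
    qed (use \<gamma>(1) in \<open>simp add: hyperballean_def\<close>)
  qed
  show "\<exists>\<alpha>\<in>radii (hyperballean \<B>). Z \<in> ball (hyperballean \<B>) Y \<alpha>"
    if YZ: "Y \<in> supp (hyperballean \<B>)" "Z \<in> supp (hyperballean \<B>)" for Y Z
  proof -
    have Y: "Y \<noteq> {}" "bounded_in \<B> Y" and Z: "Z \<noteq> {}" "bounded_in \<B> Z"
      using YZ by (auto simp: hyperballean_def)
    obtain x \<alpha> where x: "x \<in> supp \<B>" "\<alpha> \<in> radii \<B>" "Y \<subseteq> ball \<B> x \<alpha>"
      using Y unfolding bounded_in_def by blast
    obtain x' \<alpha>' where x': "x' \<in> supp \<B>" "\<alpha>' \<in> radii \<B>" "Z \<subseteq> ball \<B> x' \<alpha>'"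
      using Z unfolding bounded_in_def by blast
    obtain \<delta> where d: "\<delta> \<in> radii \<B>" "x' \<in> ball \<B> x \<delta>"
      using assms(1) x x' unfolding is_ballean_def by blast
    obtain \<eta> where e: "\<eta> \<in> radii \<B>" "\<forall>x\<in>supp \<B>. set_ball \<B> (ball \<B> x \<alpha>) \<delta> \<subseteq> ball \<B> x \<eta>"
      using comp x d by blast
    obtain \<gamma> where g: "\<gamma> \<in> radii \<B>" "\<forall>x\<in>supp \<B>. set_ball \<B> (ball \<B> x \<eta>) \<alpha>' \<subseteq> ball \<B> x \<gamma>"
      using comp x' e by blast
    have near: "z \<in> ball \<B> y \<gamma>" if "y \<in> Y" "z \<in> Z" for y z
    proof -
      have y: "y \<in> supp \<B>" "x \<in> ball \<B> y \<alpha>"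
        using that x sym bsupp[OF Y(2)] by blast+
      then have "x' \<in> ball \<B> y \<eta>"
        using e d unfolding set_ball_def by blast
      then show ?thesis
        using g y x' that unfolding set_ball_def by blast
    qed
    then have near': "y \<in> ball \<B> z \<gamma>" if "y \<in> Y" "z \<in> Z" for y z
      using that sym[OF _ g(1)] bsupp[OF Y(2)] by blast
    have "Z \<subseteq> set_ball \<B> Y \<gamma>"
      using Y(1) near unfolding set_ball_def by blast
    moreover have "Y \<subseteq> set_ball \<B> Z \<gamma>"
      using Z(1) near' unfolding set_ball_def by blast
    ultimately show ?thesis
      using Z g(1) by (intro bexI[of _ \<gamma>]) (simp_all add: hyperballean_def)
  qed
qed

end

theory Submission imports Defs begin

text \<open>
  Two finite sets \<open>Y \<noteq> Z\<close> are \<open>F\<close>-close in \<open>\<^bold>F\<^sub>X\<^sup>\<flat>\<close> iff both meet \<open>F\<close> and they agree outside \<open>F\<close>.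
  Hence a set disjoint from \<open>F\<close> has a trivial \<open>F\<close>-ball, while on families
  \<open>{Y. Y \<inter> C = {s}}\<close> the structure is that of the macrocube over \<open>X - C\<close>: the radii containing \<open>s\<close>
  impose no further condition.

  For (i), take the largest \<open>k\<close> such that some finite \<open>\<alpha>\<close> meets every member of \<open>Y\<close> in at least \<open>k\<close>
  points. By maximality, for each \<open>\<beta>\<close> some \<open>y \<in> Y\<close> meets \<open>\<alpha> \<union> \<beta>\<close> in exactly \<open>k\<close> points, all in \<open>\<alpha>\<close>;
  since all sets have \<open>n\<close> elements, the same holds for every \<open>z \<in> Y\<close> that is \<open>\<beta>\<close>-close to \<open>y\<close>.

  For (iii), the sets are sorted by their minimum. Coarse inequivalence holds because points of a
  large subset of the macrocube have nontrivial \<open>\<gamma>\<close>-balls for a uniform radius \<open>\<gamma>\<close>, whereas in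
  \<open>\<^bold>F\<^sub>\<omega>\<^sup>\<flat>\<close> every large subset contains almost all singletons \<open>{m}\<close>, and these have trivial balls.
\<close>

section \<open>The hyperballean of \<open>\<^bold>F\<^sub>X\<close>\<close>

text \<open>All balls are finite; conversely a finite set, used as radius, is the ball around each
  of its points.\<close>

lemma bounded_in_F_ballean:
  "Y \<noteq> {} \<and> bounded_in (F_ballean X) Y \<longleftrightarrow> Y \<in> Fpow X - {{}}"
proof
  assume "Y \<noteq> {} \<and> bounded_in (F_ballean X) Y"
  then show "Y \<in> Fpow X - {{}}"
    by (auto simp: bounded_in_def F_ballean_def Fpow_def split: if_splits
        intro: finite_subset)
next
  assume Y: "Y \<in> Fpow X - {{}}"
  then obtain y where "y \<in> Y" by blast
  with Y show "Y \<noteq> {} \<and> bounded_in (F_ballean X) Y"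
    by (auto simp: bounded_in_def F_ballean_def Fpow_def intro!: bexI[of _ y] exI[of _ Y])
qed

lemma set_ball_F_ballean:
  "set_ball (F_ballean X) Y F = (if Y \<inter> F = {} then Y else Y \<union> F)"
  by (auto simp: set_ball_def F_ballean_def split: if_splits)

lemma supp_hyper_F: "supp (hyperballean (F_ballean X)) = Fpow X - {{}}"
  using bounded_in_F_ballean[of _ X] by (auto simp: hyperballean_def)

lemma radii_hyper_F: "radii (hyperballean (F_ballean X)) = Fpow X"
  by (simp add: hyperballean_def F_ballean_def)

text \<open>If one of the two sets misses \<open>F\<close>, the mutual inclusions force the other to
  miss it too, and then both are equal.\<close>

lemma mem_ball_hyper_F:
  "Z \<in> ball (hyperballean (F_ballean X)) Y F \<longleftrightarrow>
     Z \<in> Fpow X - {{}} \<and> (Z = Y \<or> Y \<inter> F \<noteq> {} \<and> Z \<inter> F \<noteq> {} \<and> Y - F = Z - F)"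
proof -
  have "Z \<in> ball (hyperballean (F_ballean X)) Y F \<longleftrightarrow> Z \<in> Fpow X - {{}} \<and>
      Z \<subseteq> set_ball (F_ballean X) Y F \<and> Y \<subseteq> set_ball (F_ballean X) Z F"
    using bounded_in_F_ballean[of Z X] by (auto simp: hyperballean_def)
  then show ?thesis
    unfolding set_ball_F_ballean by (auto split: if_splits)
qed

lemma supp_subballean [simp]: "supp (subballean \<B> Y) = Y"
  and radii_subballean [simp]: "radii (subballean \<B> Y) = radii \<B>"
  and ball_subballean [simp]: "ball (subballean \<B> Y) y \<alpha> = Y \<inter> ball \<B> y \<alpha>"
  by (simp_all add: subballean_def)

section \<open>Sets of fixed cardinality\<close>

lemma nsets_asymptotically_scattered:
  assumes "infinite X" "n \<ge> 1"
  shows "asymptotically_scattered (subballean (hyperballean (F_ballean X)) (nsets X n))"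
    (is "asymptotically_scattered ?\<B>")
  unfolding asymptotically_scattered_def
proof (intro allI impI)
  fix Y assume "Y \<subseteq> supp ?\<B> \<and> \<not> bounded_in ?\<B> Y"
  then have Y: "Y \<subseteq> nsets X n" and unb: "\<not> bounded_in ?\<B> Y"
    by simp_all
  \<comment> \<open>Boundedness asks for a centre in the support, so the empty set counts as bounded
    once an \<open>n\<close>-element subset of \<open>X\<close> exists.\<close>
  have "Y \<noteq> {}"
  proof
    assume "Y = {}"
    moreover obtain N where "N \<in> nsets X n"
      using infinite_arbitrarily_large[OF assms(1), of n] by (auto simp: nsets_def)
    moreover have "{} \<in> radii ?\<B>"
      by (simp add: radii_hyper_F Fpow_def)
    ultimately show False
      using unb by (auto simp: bounded_in_def)
  qed
  then obtain y0 where y0: "y0 \<in> Y" by blast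
  have fin: "finite y" "card y = n" "y \<subseteq> X" "y \<noteq> {}" if "y \<in> Y" for y
    using that Y assms(2) by (auto simp: nsets_def)
  define P where "P k \<longleftrightarrow> (\<exists>\<alpha>\<in>Fpow X. \<forall>y\<in>Y. k \<le> card (y \<inter> \<alpha>))" for k
  have "P 0"
    by (auto simp: P_def Fpow_def)
  moreover have "k \<le> n" if Pk: "P k" for k
  proof -
    obtain \<alpha> where "k \<le> card (y0 \<inter> \<alpha>)"
      using Pk y0 by (auto simp: P_def)
    also have "\<dots> \<le> card y0"
      by (intro card_mono) (use fin[OF y0] in auto)
    finally show ?thesis using fin[OF y0] by simp
  qed
  ultimately obtain k where k: "P k" and max: "\<And>j. P j \<Longrightarrow> j \<le> k"
    using ex_has_greatest_nat[of P 0 id "Suc n"] by (auto simp: less_Suc_eq_le)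
  then obtain \<alpha> where \<alpha>: "\<alpha> \<in> Fpow X" "\<And>y. y \<in> Y \<Longrightarrow> k \<le> card (y \<inter> \<alpha>)"
    by (auto simp: P_def)
  show "\<exists>\<alpha>\<in>radii ?\<B>. \<forall>\<beta>\<in>radii ?\<B>. \<exists>y\<in>Y. (ball ?\<B> y \<beta> - ball ?\<B> y \<alpha>) \<inter> Y = {}"
  proof (rule bexI[of _ \<alpha>], rule ballI)
    fix \<beta> assume "\<beta> \<in> radii ?\<B>"
    then have \<gamma>: "\<alpha> \<union> \<beta> \<in> Fpow X"
      using \<alpha>(1) by (auto simp: radii_hyper_F Fpow_def)
    \<comment> \<open>The smaller trace \<open>z \<inter> \<alpha>\<close> already has at least
      \<open>k\<close> points.\<close>
    have in\<alpha>: "z \<inter> (\<alpha> \<union> \<beta>) = z \<inter> \<alpha>" if "z \<in> Y" "card (z \<inter> (\<alpha> \<union> \<beta>)) \<le> k" for z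
      using card_seteq[of "z \<inter> (\<alpha> \<union> \<beta>)" "z \<inter> \<alpha>"] \<alpha>(2)[of z] fin(1)[of z] that by auto
    have "\<not> P (Suc k)"
      using max by fastforce
    then obtain y where y: "y \<in> Y" "card (y \<inter> (\<alpha> \<union> \<beta>)) \<le> k"
      using \<gamma> by (auto simp: P_def not_less_eq_eq)
    have "z \<in> ball ?\<B> y \<alpha>" if z: "z \<in> Y" "z \<in> ball ?\<B> y \<beta>" for z
    proof (cases "z = y")
      case True
      then show ?thesis using z Y fin[of y] by (auto simp: mem_ball_hyper_F Fpow_def)
    next
      case False
      then have *: "y \<inter> \<beta> \<noteq> {}" "y - \<beta> = z - \<beta>"
        using z by (auto simp: mem_ball_hyper_F)
      then have out: "y - (\<alpha> \<union> \<beta>) = z - (\<alpha> \<union> \<beta>)" by blast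
      \<comment> \<open>Both sides equal \<open>n\<close>. As \<open>y\<close> and \<open>z\<close>
        agree outside \<open>\<alpha> \<union> \<beta>\<close>, their traces on it have equal
        size.\<close>
      have "card (z \<inter> (\<alpha> \<union> \<beta>)) + card (z - (\<alpha> \<union> \<beta>)) = card (y \<inter> (\<alpha> \<union> \<beta>)) + card (y - (\<alpha> \<union> \<beta>))"
        using fin[of z] fin[of y] z(1) y(1) by (simp add: card_Int_Diff[symmetric])
      then have cz: "card (z \<inter> (\<alpha> \<union> \<beta>)) \<le> k"
        using out y(2) by simp
      have y\<alpha>: "y \<inter> (\<alpha> \<union> \<beta>) = y \<inter> \<alpha>" and z\<alpha>: "z \<inter> (\<alpha> \<union> \<beta>) = z \<inter> \<alpha>"
        using in\<alpha> y z cz by auto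
      have "y \<inter> \<alpha> \<noteq> {}"
        using *(1) y\<alpha> by blast
      \<comment> \<open>This gives \<open>0 < k\<close>, so every member of \<open>Y\<close> meets
        \<open>\<alpha>\<close>, in particular \<open>z\<close>.\<close>
      then have "0 < card (y \<inter> (\<alpha> \<union> \<beta>))"
        using y\<alpha> fin(1)[OF y(1)] by (simp add: card_gt_0_iff)
      then have "z \<inter> \<alpha> \<noteq> {}"
        using y(2) \<alpha>(2)[OF z(1)] by auto
      moreover have "y - \<alpha> = z - \<alpha>"
        using out y\<alpha> z\<alpha> by blast
      ultimately show ?thesis
        using \<open>y \<inter> \<alpha> \<noteq> {}\<close> z Y fin[of z] by (auto simp: mem_ball_hyper_F Fpow_def)
    qed
    then show "\<exists>y\<in>Y. (ball ?\<B> y \<beta> - ball ?\<B> y \<alpha>) \<inter> Y = {}"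
      using y(1) by blast
  qed (use \<alpha> in \<open>simp add: radii_hyper_F\<close>)
qed

section \<open>Macrocubes in the hyperballean\<close>

text \<open>Trades \<open>inv_into\<close> for an explicit inverse \<open>g\<close>. The two agree
  only on the support, hence the assumption \<open>sub\<close> that balls stay inside it.\<close>

lemma is_asymorphismI:
  assumes f: "f \<in> supp \<B> \<rightarrow> supp \<B>'" and g: "g \<in> supp \<B>' \<rightarrow> supp \<B>"
    and gf: "\<And>x. x \<in> supp \<B> \<Longrightarrow> g (f x) = x" and fg: "\<And>y. y \<in> supp \<B>' \<Longrightarrow> f (g y) = y"
    and cf: "\<And>\<alpha>. \<alpha> \<in> radii \<B> \<Longrightarrow>
      \<exists>\<alpha>'\<in>radii \<B>'. \<forall>x\<in>supp \<B>. \<forall>x'\<in>ball \<B> x \<alpha>. f x' \<in> ball \<B>' (f x) \<alpha>'"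
    and cg: "\<And>\<alpha>. \<alpha> \<in> radii \<B>' \<Longrightarrow>
      \<exists>\<alpha>'\<in>radii \<B>. \<forall>y\<in>supp \<B>'. \<forall>y'\<in>ball \<B>' y \<alpha>. g y' \<in> ball \<B> (g y) \<alpha>'"
    and sub: "\<And>y \<alpha>. y \<in> supp \<B>' \<Longrightarrow> \<alpha> \<in> radii \<B>' \<Longrightarrow> ball \<B>' y \<alpha> \<subseteq> supp \<B>'"
  shows "is_asymorphism \<B> \<B>' f"
proof -
  have bij: "bij_betw f (supp \<B>) (supp \<B>')"
    by (rule bij_betw_byWitness[of _ g]) (use f g gf fg in auto)
  have inv: "inv_into (supp \<B>) f y = g y" if "y \<in> supp \<B>'" for y
    using that bij g fg by (intro inv_into_f_eq) (auto simp: bij_betw_def)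
  have "is_coarse \<B> \<B>' f"
    using f cf unfolding is_coarse_def image_subset_iff by blast
  moreover have "is_coarse \<B>' \<B> (inv_into (supp \<B>) f)"
    unfolding is_coarse_def image_subset_iff
  proof (intro conjI ballI)
    show "inv_into (supp \<B>) f \<in> supp \<B>' \<rightarrow> supp \<B>"
      using g inv by auto
    fix \<alpha> assume \<alpha>: "\<alpha> \<in> radii \<B>'"
    obtain \<alpha>' where \<alpha>': "\<alpha>' \<in> radii \<B>"
      "\<forall>y\<in>supp \<B>'. \<forall>y'\<in>ball \<B>' y \<alpha>. g y' \<in> ball \<B> (g y) \<alpha>'"
      using cg[OF \<alpha>] by blast
    then show "\<exists>\<alpha>'\<in>radii \<B>. \<forall>y\<in>supp \<B>'. \<forall>y'\<in>ball \<B>' y \<alpha>.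
        inv_into (supp \<B>) f y' \<in> ball \<B> (inv_into (supp \<B>) f y) \<alpha>'"
      using inv sub[OF _ \<alpha>] by (intro bexI[of _ \<alpha>'] ballI) (metis subsetD, simp)
  qed
  ultimately show ?thesis
    using bij by (simp add: is_asymorphism_def)
qed

text \<open>A member \<open>F\<close> is determined by \<open>F - C\<close>; \<open>f\<close> takes
  its characteristic function along \<open>h\<close>, and \<open>g\<close> adds \<open>s\<close>
  back. A general \<open>C\<close> serves both (ii), with one point removed, and (iii), with an
  initial segment removed.\<close>

lemma asymorphic_Q_ballean:
  assumes h: "bij_betw h K (X - C)" and s: "s \<in> C" "s \<in> X"
  shows "asymorphic (subballean (hyperballean (F_ballean X)) {F \<in> Fpow X. F \<inter> C = {s}})
    (Q_ballean K)"
    (is "asymorphic ?\<B> _")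
proof -
  define f :: "_ set \<Rightarrow> _ \<Rightarrow> nat" where "f F = (\<lambda>a\<in>K. if h a \<in> F then 1 else 0)" for F
  define g :: "(_ \<Rightarrow> nat) \<Rightarrow> _ set" where "g q = insert s (h ` {a \<in> K. q a \<noteq> 0})" for q
  have inj: "inj_on h K" and im: "h ` K = X - C"
    using h by (auto simp: bij_betw_def)
  have hK: "h a \<in> X" "h a \<notin> C" "h a \<noteq> s" if "a \<in> K" for a
    using im s that by auto
  have suppQ: "supp (Q_ballean K) = Q_support K"
    and rad: "radii (Q_ballean K) = Fpow K"
    by (simp_all add: radii_hyper_F Q_ballean_def)
  have fin_vimage: "finite {a \<in> K. h a \<in> F}" if "finite F" for F
    using finite_vimage_IntI[OF that inj] by (simp add: vimage_def Int_def conj_commute)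
  have fQ: "f F \<in> Q_support K" if "finite F" for F
  proof -
    have "{a \<in> K. f F a \<noteq> 0} = {a \<in> K. h a \<in> F}"
      by (auto simp: f_def)
    then show ?thesis
      using fin_vimage[OF that] by (auto simp: Q_support_def f_def)
  qed
  have g_mem: "h a \<in> g q \<longleftrightarrow> q a \<noteq> 0" if "a \<in> K" for a q
    using that hK inj by (auto simp: g_def inj_on_def)
  have "is_asymorphism ?\<B> (Q_ballean K) f"
  proof (rule is_asymorphismI[of _ _ _ g])
    show "f \<in> supp ?\<B> \<rightarrow> supp (Q_ballean K)"
      using fQ by (auto simp: suppQ Fpow_def)
    show gsupp: "g \<in> supp (Q_ballean K) \<rightarrow> supp ?\<B>"
      using hK s by (auto simp: suppQ Q_support_def Fpow_def g_def)
    show "g (f F) = F" if "F \<in> supp ?\<B>" for F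
    proof -
      have F: "F \<subseteq> X" "F \<inter> C = {s}"
        using that by (auto simp: Fpow_def)
      have "g (f F) = insert s (h ` {a \<in> K. h a \<in> F})"
        by (auto simp: g_def f_def cong: conj_cong split: if_splits)
      also have "h ` {a \<in> K. h a \<in> F} = F \<inter> (X - C)"
        using im by auto
      finally show ?thesis using F by auto
    qed
    show "f (g q) = q" if "q \<in> supp (Q_ballean K)" for q
    proof
      fix a
      have q: "q \<in> K \<rightarrow>\<^sub>E {0, 1}"
        using that by (simp add: suppQ Q_support_def)
      show "f (g q) a = q a"
      proof (cases "a \<in> K")
        case True
        then have "q a = 0 \<or> q a = 1"
          using PiE_mem[OF q] by simp
        then show ?thesis
          using True by (auto simp: f_def g_mem)
      next
        case False
        then show ?thesis
          using PiE_arb[OF q] by (simp add: f_def)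
      qed
    qed
    show "\<exists>\<alpha>'\<in>radii (Q_ballean K). \<forall>F\<in>supp ?\<B>. \<forall>F'\<in>ball ?\<B> F \<alpha>. f F' \<in> ball (Q_ballean K) (f F) \<alpha>'"
      if "\<alpha> \<in> radii ?\<B>" for \<alpha>
    \<comment> \<open>Agreement outside \<open>\<alpha>\<close> becomes agreement of coordinates
      outside its preimage, which is finite because \<open>h\<close> is injective.\<close>
    proof (intro bexI[of _ "{a \<in> K. h a \<in> \<alpha>}"] ballI)
      show "{a \<in> K. h a \<in> \<alpha>} \<in> radii (Q_ballean K)"
        using that fin_vimage by (auto simp: rad radii_hyper_F Fpow_def)
      fix F F' assume "F' \<in> ball ?\<B> F \<alpha>"
      then have "finite F'" "F - \<alpha> = F' - \<alpha>"
        by (auto simp: mem_ball_hyper_F Fpow_def)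
      then show "f F' \<in> ball (Q_ballean K) (f F) {a \<in> K. h a \<in> \<alpha>}"
        using fQ[of F'] by (auto simp: Q_ballean_def f_def)
    qed
    show "\<exists>\<alpha>'\<in>radii ?\<B>. \<forall>q\<in>supp (Q_ballean K). \<forall>q'\<in>ball (Q_ballean K) q \<alpha>. g q' \<in> ball ?\<B> (g q) \<alpha>'"
      if "\<alpha> \<in> radii (Q_ballean K)" for \<alpha>
    \<comment> \<open>With \<open>s\<close> in the radius, all members meet it, and only agreement
      outside the radius remains to be shown.\<close>
    proof (intro bexI[of _ "insert s (h ` \<alpha>)"] ballI)
      show "insert s (h ` \<alpha>) \<in> radii ?\<B>"
        using that hK s by (auto simp: rad radii_hyper_F Fpow_def)
      fix q q' assume q': "q' \<in> ball (Q_ballean K) q \<alpha>"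
      then have "g q' \<in> supp ?\<B>"
        using gsupp by (auto simp: Q_ballean_def)
      moreover have "s \<in> g q" "s \<in> g q'"
        by (simp_all add: g_def)
      moreover have "q a = q' a" if "a \<in> K" "h a \<notin> h ` \<alpha>" for a
        using q' that imageI[of a \<alpha> h] by (auto simp: Q_ballean_def)
      then have "g q - insert s (h ` \<alpha>) = g q' - insert s (h ` \<alpha>)"
        unfolding g_def by fastforce
      ultimately show "g q' \<in> ball ?\<B> (g q) (insert s (h ` \<alpha>))"
        by (auto simp: mem_ball_hyper_F)
    qed
  qed (auto simp: Q_ballean_def)
  then show ?thesis
    by (auto simp: asymorphic_def)
qed

text \<open>Removing one point from an infinite set leaves a set of the same size, which supplies
  \<open>h\<close>.\<close>

lemma asymorphic_Q_ballean_point: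
  assumes "infinite X" "x \<in> X"
  shows "asymorphic (subballean (hyperballean (F_ballean X)) {F \<in> Fpow X. x \<in> F}) (Q_ballean X)"
proof -
  obtain h where "bij_betw h X (X - {x})"
    using infinite_imp_bij_betw[OF assms(1)] by blast
  moreover have "{F \<in> Fpow X. x \<in> F} = {F \<in> Fpow X. F \<inter> {x} = {x}}"
    by auto
  ultimately show ?thesis
    using asymorphic_Q_ballean[of h X X "{x}" x] assms(2) by simp
qed

lemma partition_into_macrocubes:
  "\<exists>\<P>. partition_on (supp (hyperballean (F_ballean (UNIV :: nat set)))) \<P> \<and>
     countable \<P> \<and> infinite \<P> \<and>
     pairwise (close_in (hyperballean (F_ballean (UNIV :: nat set)))) \<P> \<and>
     (\<forall>Y\<in>\<P>. asymorphic (subballean (hyperballean (F_ballean (UNIV :: nat set))) Y)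
        (Q_ballean (UNIV :: nat set)))"
proof -
  let ?\<H> = "hyperballean (F_ballean (UNIV :: nat set))"
  \<comment> \<open>The sets with minimum \<open>m\<close>, in the shape that
    \<open>asymorphic_Q_ballean\<close> takes with \<open>C = {..m}\<close>.\<close>
  define A where "A m = {F \<in> Fpow UNIV. F \<inter> {..m} = {m}}" for m :: nat
  have A_Min: "F \<in> A m \<longleftrightarrow> finite F \<and> F \<noteq> {} \<and> Min F = m" for F m
  proof (cases "finite F \<and> F \<noteq> {}")
    case True
    then have "Min F = m \<longleftrightarrow> m \<in> F \<and> (\<forall>a\<in>F. m \<le> a)"
      by (intro Min_eq_iff) auto
    also have "\<dots> \<longleftrightarrow> F \<inter> {..m} = {m}"
      by (auto simp: set_eq_iff)
    finally show ?thesis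
      using True by (auto simp: A_def Fpow_def)
  qed (auto simp: A_def Fpow_def)
  have single: "{m} \<in> A m" for m
    by (auto simp: A_def Fpow_def)
  have "inj A"
  proof (rule injI)
    fix i j assume "A i = A j"
    then have "{i} \<in> A j"
      using single[of i] by simp
    then show "i = j"
      by (simp add: A_Min)
  qed
  have sup: "A m \<subseteq> supp ?\<H>" for m
    by (auto simp: supp_hyper_F A_def)
  have close: "A i \<subseteq> set_ball ?\<H> (A j) {..max i j}" for i j
  proof
    fix F assume "F \<in> A i"
    then have F: "finite F" "F \<inter> {..i} = {i}"
      by (auto simp: A_def Fpow_def)
    \<comment> \<open>Erasing the part of \<open>F\<close> up to \<open>max i j\<close> and
      inserting \<open>j\<close> makes \<open>j\<close> the minimum. Both sets meet the radius,
      through \<open>i\<close> and \<open>j\<close>, and agree beyond it.\<close>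
    let ?G = "insert j (F - {..max i j})"
    have "?G \<in> A j"
      using F by (auto simp: A_def Fpow_def)
    moreover have "F \<in> ball ?\<H> ?G {..max i j}"
      using F by (auto simp: mem_ball_hyper_F Fpow_def)
    ultimately show "F \<in> set_ball ?\<H> (A j) {..max i j}"
      unfolding set_ball_def by blast
  qed
  have "partition_on (supp ?\<H>) (range A)"
  proof (rule partition_onI)
    show "\<Union> (range A) = supp ?\<H>"
      using sup by (auto simp: supp_hyper_F A_Min Fpow_def)
    show "disjnt p q" if "p \<in> range A" "q \<in> range A" "p \<noteq> q" for p q
      using that by (auto simp: disjnt_def A_Min)
    show "{} \<notin> range A"
      using single by blast
  qed
  moreover have "infinite (range A)"
    using \<open>inj A\<close> finite_imageD by blast
  moreover have "pairwise (close_in ?\<H>) (range A)"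
  proof (rule pairwiseI)
    fix p q assume "p \<in> range A" "q \<in> range A"
    then obtain i j where [simp]: "p = A i" "q = A j" by blast
    have "{..max i j} \<in> radii ?\<H>"
      by (simp add: radii_hyper_F Fpow_def)
    then show "close_in ?\<H> p q"
      using sup close[of i j] close[of j i] unfolding close_in_def
      by (auto simp: max.commute)
  qed
  moreover have "asymorphic (subballean ?\<H> (A m)) (Q_ballean (UNIV :: nat set))" for m
  proof -
    have "bij_betw (\<lambda>a. a + Suc m) UNIV (UNIV - {..m})"
      by (rule bij_betw_byWitness[of _ "\<lambda>a. a - Suc m"]) auto
    then show ?thesis
      unfolding A_def by (rule asymorphic_Q_ballean) auto
  qed
  ultimately show ?thesis
    by (intro exI[of _ "range A"]) auto
qed

section \<open>Coarse inequivalence\<close>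

text \<open>Flip a coordinate \<open>a\<close> outside the covering radius \<open>\<alpha>\<close>
  of \<open>L\<close>: a point of \<open>L\<close> that is \<open>\<alpha>\<close>-close to the
  flipped point keeps the flipped value at \<open>a\<close>, so it differs from
  \<open>x\<close>.\<close>

lemma large_subset_Q_ballean:
  assumes "infinite K" "large_in (Q_ballean K) L"
  obtains \<gamma> where "\<gamma> \<in> Fpow K" "\<And>x. x \<in> L \<Longrightarrow> \<exists>x'\<in>L. x' \<noteq> x \<and> x' \<in> ball (Q_ballean K) x \<gamma>"
proof -
  have L: "L \<subseteq> Q_support K"
    using assms(2) by (simp add: large_in_def Q_ballean_def)
  obtain \<alpha> where \<alpha>: "\<alpha> \<in> Fpow K" "Q_support K = set_ball (Q_ballean K) L \<alpha>"
    using assms(2) by (auto simp: large_in_def Q_ballean_def)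
  have "infinite (K - \<alpha>)"
    using \<alpha>(1) assms(1) by (simp add: Fpow_def Diff_infinite_finite)
  then obtain a where a: "a \<in> K" "a \<notin> \<alpha>"
    by (metis Diff_iff infinite_imp_nonempty ex_in_conv)
  show ?thesis
  proof
    show "insert a \<alpha> \<in> Fpow K"
      using \<alpha> a by (auto simp: Fpow_def)
    fix x assume x: "x \<in> L"
    define y where "y = x(a := 1 - x a)"
    have "finite {b \<in> K. y b \<noteq> 0}"
      by (rule finite_subset[of _ "insert a {b \<in> K. x b \<noteq> 0}"])
        (use x L in \<open>auto simp: y_def Q_support_def split: if_splits\<close>)
    moreover have "y \<in> K \<rightarrow>\<^sub>E {0, 1}"
      using x L a unfolding y_def Q_support_def PiE_def Pi_def extensional_def by fastforce
    ultimately have "y \<in> set_ball (Q_ballean K) L \<alpha>"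
      unfolding \<alpha>(2)[symmetric] by (simp add: Q_support_def)
    then obtain x' where x': "x' \<in> L" "\<forall>b\<in>K - \<alpha>. x' b = y b"
      by (auto simp: set_ball_def Q_ballean_def)
    have "x' a = 1 - x a"
      using x'(2) a by (simp add: y_def)
    then have "x' a \<noteq> x a"
      by arith
    then have "x' \<noteq> x"
      by blast
    moreover have "x' \<in> ball (Q_ballean K) x (insert a \<alpha>)"
      using x' L by (auto simp: Q_ballean_def y_def)
    ultimately show "\<exists>x'\<in>L. x' \<noteq> x \<and> x' \<in> ball (Q_ballean K) x (insert a \<alpha>)"
      using x'(1) by blast
  qed
qed

lemma not_coarsely_equivalent_Q_ballean:
  assumes "infinite X" "infinite K"
  shows "\<not> coarsely_equivalent (hyperballean (F_ballean X)) (Q_ballean K)"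
proof
  let ?\<H> = "hyperballean (F_ballean X)"
  assume "coarsely_equivalent ?\<H> (Q_ballean K)"
  then obtain L L' f where L: "large_in ?\<H> L" and L': "large_in (Q_ballean K) L'"
    and f: "is_asymorphism (subballean ?\<H> L) (subballean (Q_ballean K) L') f"
    by (auto simp: coarsely_equivalent_def asymorphic_def)
  obtain \<gamma> where \<gamma>: "\<gamma> \<in> Fpow K" "\<And>x. x \<in> L' \<Longrightarrow> \<exists>x'\<in>L'. x' \<noteq> x \<and> x' \<in> ball (Q_ballean K) x \<gamma>"
    using large_subset_Q_ballean[OF assms(2) L'] by blast
  have bij: "bij_betw f L L'"
    using f by (simp add: is_asymorphism_def)
  have "\<gamma> \<in> radii (Q_ballean K)"
    using \<gamma> by (simp add: Q_ballean_def)
  \<comment> \<open>Coarseness of the inverse of \<open>f\<close> carries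
    \<open>\<gamma>\<close>-neighbours in \<open>L'\<close> to \<open>\<delta>\<close>-neighbours in
    \<open>L\<close>.\<close>
  then obtain \<delta> where \<delta>: "\<delta> \<in> Fpow X"
    "\<And>x. x \<in> L' \<Longrightarrow> inv_into L f ` (L' \<inter> ball (Q_ballean K) x \<gamma>) \<subseteq> ball ?\<H> (inv_into L f x) \<delta>"
    using f unfolding is_asymorphism_def is_coarse_def by (auto simp: radii_hyper_F)
  obtain \<alpha> where \<alpha>: "\<alpha> \<in> Fpow X" "Fpow X - {{}} = set_ball ?\<H> L \<alpha>"
    using L by (auto simp: large_in_def supp_hyper_F radii_hyper_F)
  \<comment> \<open>A point \<open>m\<close> outside \<open>\<alpha>\<close> gives
    \<open>{m} \<in> L\<close>, since only \<open>{m}\<close> itself can cover it; outside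
    \<open>\<delta>\<close> the ball of \<open>{m}\<close> is trivial, leaving no room for the image
    of a second point.\<close>
  have "infinite (X - (\<alpha> \<union> \<delta>))"
    using \<alpha>(1) \<delta>(1) assms(1) by (simp add: Fpow_def Diff_infinite_finite)
  then obtain m where m: "m \<in> X" "m \<notin> \<alpha> \<union> \<delta>"
    by (metis Diff_iff infinite_imp_nonempty ex_in_conv)
  then have "{m} \<in> set_ball ?\<H> L \<alpha>"
    unfolding \<alpha>(2)[symmetric] by (simp add: Fpow_def)
  then have "{m} \<in> L"
    using m unfolding set_ball_def by (auto simp: mem_ball_hyper_F)
  then have fm: "f {m} \<in> L'" "inv_into L f (f {m}) = {m}"
    using bij by (auto simp: bij_betw_def)
  then obtain x' where x': "x' \<in> L'" "x' \<noteq> f {m}" "x' \<in> ball (Q_ballean K) (f {m}) \<gamma>"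
    using \<gamma>(2) by blast
  then have "inv_into L f x' \<in> ball ?\<H> {m} \<delta>"
    using \<delta>(2)[OF fm(1)] fm(2) by auto
  then have "inv_into L f x' = {m}"
    using m by (auto simp: mem_ball_hyper_F)
  moreover have "f (inv_into L f x') = x'"
    using bij x'(1) by (auto simp: bij_betw_def f_inv_into_f)
  ultimately show False
    using x'(2) by simp
qed

theorem theorem2p2:
  fixes \<kappa> :: "'a rel" and n :: nat and x :: 'a
  assumes "Cinfinite \<kappa>" and "n \<ge> 1" and "x \<in> Field \<kappa>"
  shows
    "asymptotically_scattered
       (subballean (hyperballean (F_ballean (Field \<kappa>))) (nsets (Field \<kappa>) n)) \<and>
     asymorphic
       (subballean (hyperballean (F_ballean (Field \<kappa>))) {F \<in> Fpow (Field \<kappa>). x \<in> F})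
       (Q_ballean (Field \<kappa>)) \<and>
     (\<exists>\<P>. partition_on (supp (hyperballean (F_ballean (UNIV :: nat set)))) \<P> \<and>
        countable \<P> \<and> infinite \<P> \<and>
        pairwise (close_in (hyperballean (F_ballean (UNIV :: nat set)))) \<P> \<and>
        (\<forall>Y\<in>\<P>. asymorphic (subballean (hyperballean (F_ballean (UNIV :: nat set))) Y)
           (Q_ballean (UNIV :: nat set)))) \<and>
     \<not> coarsely_equivalent (hyperballean (F_ballean (UNIV :: nat set)))
         (Q_ballean (UNIV :: nat set))"
proof -
  have "infinite (Field \<kappa>)"
    using assms(1) by (simp add: cinfinite_def)
  then show ?thesis
    by (intro conjI nsets_asymptotically_scattered asymorphic_Q_ballean_point
        partition_into_macrocubes not_coarsely_equivalent_Q_ballean assms(2,3) infinite_UNIV_nat)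
qed

end
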